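(* Let $q$ be a prime power, $0<k<n$ and $0\le t\le k$ integers, and let $C\in\mathcal{C}_t(n,k)$. The orbit of $C$ under the action of the monomial group $\mathcal{M}(V)$ is contained in a single connected component of the graph $\Delta_t(n,k)$.
   Context: Let $V=\mathbb{F}_q^n$ with standard basis $e_1,\dots,e_n$. An $[n,k]$-linear code is a $k$-dimensional subspace of $V$; $\mathcal{C}_t(n,k)$ denotes the set of $[n,k]$-codes such that any $t$ columns of a generator matrix (a $k\times n$ matrix whose rows form a basis) are linearly independent. $\Delta_t(n,k)$ is the graph with vertex set $\mathcal{C}_t(n,k)$ in which $X,Y$ are adjacent iff $\dim(X\cap Y)=k-1$. The monomial group $\mathcal{M}(V)$ is the group of linear transformations of $V$ mapping the set $\{\langle e_1\rangle,\dots,\langle e_n\rangle\}$ to itself (matrices that are a permutation matrix times an invertible diagonal matrix); it acts on subspaces of $V$. *)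

theory Defs
  imports "HOL-Analysis.Analysis" "HOL-Algebra.Group_Action"
begin

text \<open>
  \<open>\<F>\<^sub>q\<close> is a type \<open>'a\<close> of classes \<open>field\<close> and \<open>finite\<close>, with \<open>q = CARD('a)\<close>, and the ambient space is
  \<open>'a ^ 'n\<close>, with \<open>n = CARD('n)\<close>. The rows of a generator matrix are indexed by a finite type \<open>'k\<close>,
  with \<open>k = CARD('k)\<close>; the notions depending on \<open>k\<close> take \<open>TYPE('k)\<close> as an argument.
\<close>

definition linear_code :: "nat \<Rightarrow> ('a::field ^ 'n) set \<Rightarrow> bool" where
  "linear_code k C \<longleftrightarrow> vec.subspace C \<and> vec.dim C = k"

definition generator_matrix :: "'a::field ^ 'n ^ 'k \<Rightarrow> ('a ^ 'n) set \<Rightarrow> bool" where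
  "generator_matrix G C \<longleftrightarrow>
     inj (\<lambda>i. row i G) \<and> vec.independent (rows G) \<and> vec.span (rows G) = C"

text \<open>
  Columns are taken as a family indexed by positions, so two equal columns in different positions
  are linearly dependent; this is the purpose of the injectivity condition.
\<close>

definition any_columns_independent :: "nat \<Rightarrow> 'a::field ^ 'n ^ 'k \<Rightarrow> bool" where
  "any_columns_independent t G \<longleftrightarrow>
     (\<forall>J :: 'n set. card J = t \<longrightarrow>
        inj_on (\<lambda>j. column j G) J \<and> vec.independent ((\<lambda>j. column j G) ` J))"

definition codes :: "'k::finite itself \<Rightarrow> nat \<Rightarrow> ('a::field ^ 'n) set set" where
  "codes (_ :: 'k itself) t =
     {C. linear_code CARD('k) C \<and>
         (\<exists>G :: 'a ^ 'n ^ 'k. generator_matrix G C \<and> any_columns_independent t G)}"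

definition code_graph_edges ::
  "'k::finite itself \<Rightarrow> nat \<Rightarrow> (('a::field ^ 'n) set \<times> ('a ^ 'n) set) set" where
  "code_graph_edges (K :: 'k itself) t =
     {(X, Y). X \<in> codes K t \<and> Y \<in> codes K t \<and> vec.dim (X \<inter> Y) = CARD('k) - 1}"

definition connected_components :: "'v set \<Rightarrow> ('v \<times> 'v) set \<Rightarrow> 'v set set" where
  "connected_components V E = V // {(x, y). x \<in> V \<and> y \<in> V \<and> (x, y) \<in> E\<^sup>*}"

definition coordinate_lines :: "('a::field ^ 'n) set set" where
  "coordinate_lines = range (\<lambda>i. vec.span {axis i 1})"

definition monomial_group :: "('a::field ^ 'n \<Rightarrow> 'a ^ 'n) monoid" where
  "monomial_group =
     \<lparr>carrier = {f. Vector_Spaces.linear (*s) (*s) f \<and> bij f \<and>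
                    (\<lambda>L. f ` L) ` coordinate_lines = coordinate_lines},
      monoid.mult = (\<circ>), one = id\<rparr>"

lemma group_monomial_group: "group (monomial_group :: ('a::field ^ 'n \<Rightarrow> 'a ^ 'n) monoid)"
proof (rule groupI)
  fix f g :: "'a ^ 'n \<Rightarrow> 'a ^ 'n"
  assume "f \<in> carrier monomial_group" "g \<in> carrier monomial_group"
  moreover have "(\<lambda>L. (f \<circ> g) ` L) ` A = (\<lambda>L. f ` L) ` (\<lambda>L. g ` L) ` A" for A
    by (simp add: image_image image_comp)
  ultimately show "f \<otimes>\<^bsub>monomial_group\<^esub> g \<in> carrier monomial_group"
    by (auto simp: monomial_group_def intro: Vector_Spaces.linear_compose bij_comp)
next
  fix f :: "'a ^ 'n \<Rightarrow> 'a ^ 'n"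
  assume "f \<in> carrier monomial_group"
  then have lin: "Vector_Spaces.linear (*s) (*s) f" and bij: "bij f"
    and lines: "(\<lambda>L. f ` L) ` coordinate_lines = coordinate_lines"
    by (auto simp: monomial_group_def)
  obtain g where g: "Vector_Spaces.linear (*s) (*s) g" "g \<circ> f = id"
    using vec.linear_injective_left_inverse [OF lin] bij bij_is_inj by blast
  with bij have g_inv: "g = Hilbert_Choice.inv f"
    by (metis bij_is_surj comp_assoc comp_id id_comp surj_iff)
  have "(\<lambda>L. g ` L) ` coordinate_lines = (\<lambda>L. g ` L) ` (\<lambda>L. f ` L) ` coordinate_lines"
    by (simp add: lines)
  also have "\<dots> = coordinate_lines"
    using g(2) by (simp add: image_image fun_eq_iff)
  finally have "g \<in> carrier monomial_group"
    using g g_inv bij by (simp add: monomial_group_def bij_imp_bij_inv)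
  then show "\<exists>g\<in>carrier monomial_group. g \<otimes>\<^bsub>monomial_group\<^esub> f = \<one>\<^bsub>monomial_group\<^esub>"
    using g(2) by (auto simp: monomial_group_def)
qed (auto simp: monomial_group_def comp_assoc vec.linear_id)

end

theory Submission
  imports Defs
begin

text \<open>
  The monomial group is generated by transpositions of two coordinates and rescalings of a single
  coordinate. For each such generator \<open>f\<close> the map \<open>f - id\<close> has rank at most one, so \<open>f\<close> fixes a
  hyperplane pointwise, and a code \<open>C\<close> meets its image \<open>f C\<close> in codimension at most one.
\<close>

section \<open>Monomial maps in coordinates\<close>

text \<open>Indices are pulled back: for bijective \<open>p\<close>, the vector
  \<open>axis (p l) 1\<close> goes to \<open>a l *s axis l 1\<close>. Hence permutations compose in
  reversed order.\<close>

definition monomial_map :: "('n \<Rightarrow> 'n) \<Rightarrow> ('n \<Rightarrow> 'a) \<Rightarrow> 'a::field ^ 'n \<Rightarrow> 'a ^ 'n" where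
  "monomial_map p a x = (\<chi> l. a l * x $ p l)"

lemma linear_monomial_map: "Vector_Spaces.linear (*s) (*s) (monomial_map p a)"
  by unfold_locales
    (simp_all add: monomial_map_def vec_eq_iff algebra_simps)

lemma inj_monomial_map:
  assumes "bij p" "\<And>l. a l \<noteq> 0"
  shows "inj (monomial_map p a)"
proof (rule injI)
  fix x y assume "monomial_map p a x = monomial_map p a y"
  then have "x $ p l = y $ p l" for l
    using assms(2)[of l] by (auto simp: monomial_map_def vec_eq_iff)
  then show "x = y"
    using bij_is_surj[OF assms(1)] by (metis surjD vec_eq_iff)
qed

lemma monomial_map_factor: "monomial_map p a = monomial_map id a \<circ> monomial_map p (\<lambda>_. 1)"
  by (simp add: fun_eq_iff monomial_map_def)

section \<open>Invariance of the vertex set\<close>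

text \<open>Passes from a set of columns to coefficients indexed by positions, where permuting and
  rescaling the columns is a mere substitution in the coefficients.\<close>

lemma independent_family_iff:
  fixes v :: "'i \<Rightarrow> 'a::field ^ 'n"
  assumes "finite J"
  shows "inj_on v J \<and> vec.independent (v ` J) \<longleftrightarrow>
    (\<forall>u. (\<Sum>j\<in>J. u j *s v j) = 0 \<longrightarrow> (\<forall>j\<in>J. u j = 0))"
    (is "?L \<longleftrightarrow> ?R")
proof
  assume L: ?L
  show ?R
  proof (intro allI impI)
    fix u assume 0: "(\<Sum>j\<in>J. u j *s v j) = 0"
    have "(\<Sum>w\<in>v ` J. u (the_inv_into J v w) *s w) = (\<Sum>j\<in>J. u j *s v j)"
      using L by (simp add: sum.reindex the_inv_into_f_f)
    with 0 have "(\<Sum>w\<in>v ` J. u (the_inv_into J v w) *s w) = 0" by simp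
    then have "\<forall>w\<in>v ` J. u (the_inv_into J v w) = 0"
      using L assms by (intro ballI vec.independentD[of "v ` J" "v ` J"]) auto
    with L show "\<forall>j\<in>J. u j = 0"
      by (simp add: the_inv_into_f_f)
  qed
next
  assume R: ?R
  have inj: "inj_on v J"
  proof (rule inj_onI, rule ccontr)
    fix i j assume ij: "i \<in> J" "j \<in> J" "v i = v j" "i \<noteq> j"
    \<comment> \<open>A repeated value gives the nontrivial relation
      \<open>v i - v j = 0\<close>.\<close>
    let ?u = "\<lambda>l. if l = i then 1 else if l = j then -1 else (0::'a)"
    have "(\<Sum>l\<in>J. ?u l *s v l) = (\<Sum>l\<in>{i, j}. ?u l *s v l)"
      using ij assms by (intro sum.mono_neutral_right) auto
    also have "\<dots> = 0" using ij by simp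
    finally show False using R ij(1) by fastforce
  qed
  moreover have "vec.independent (v ` J)"
  proof (rule vec.independent_if_scalars_zero)
    fix f w assume "(\<Sum>x\<in>v ` J. f x *s x) = 0" "w \<in> v ` J"
    with R[rule_format, of "f \<circ> v"] inj show "f w = 0"
      by (auto simp: sum.reindex)
  qed (use assms in simp)
  ultimately show ?L ..
qed

lemma any_columns_independent_monomial:
  fixes G :: "'a::field ^ 'n ^ 'k"
  assumes "any_columns_independent t G" "bij p" "\<And>l. a l \<noteq> 0"
  shows "any_columns_independent t (\<chi> r. monomial_map p a (G $ r))"
  unfolding any_columns_independent_def
proof (intro allI impI)
  fix J :: "'n set" assume J: "card J = t"
  let ?G = "\<chi> r. monomial_map p a (G $ r)"
  have p: "inj_on p J" using assms(2) by (meson bij_is_inj inj_on_subset subset_UNIV)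
  have col: "column l ?G = a l *s column (p l) G" for l
    by (simp add: column_def monomial_map_def vec_eq_iff)
  have G: "\<forall>u. (\<Sum>j\<in>p ` J. u j *s column j G) = 0 \<longrightarrow> (\<forall>j\<in>p ` J. u j = 0)"
    using assms(1) J p
    by (subst independent_family_iff[symmetric])
      (simp_all add: any_columns_independent_def card_image)
  show "inj_on (\<lambda>j. column j ?G) J \<and> vec.independent ((\<lambda>j. column j ?G) ` J)"
  proof (subst independent_family_iff, simp, intro allI impI)
    fix u assume 0: "(\<Sum>j\<in>J. u j *s column j ?G) = 0"
    \<comment> \<open>Moving \<open>u\<close> along \<open>p\<close> and absorbing the scalars turns
      a relation between new columns into one between old columns.\<close>
    let ?w = "\<lambda>m. u (the_inv p m) * a (the_inv p m)"
    have inv: "the_inv p (p j) = j" for j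
      using assms(2) by (simp add: bij_is_inj the_inv_f_f)
    have "(\<Sum>j\<in>p ` J. ?w j *s column j G) = 0"
      using 0 p by (simp add: sum.reindex inv col)
    with G[rule_format, of ?w] have "\<forall>j\<in>p ` J. ?w j = 0" by blast
    then show "\<forall>j\<in>J. u j = 0" using assms(3) by (simp add: inv)
  qed
qed

text \<open>An injective linear map carries a basis of \<open>C\<close> to a basis of its image, so
  applying it to each row of a generator matrix yields a generator matrix.\<close>

lemma codes_monomial_image:
  fixes C :: "('a::field ^ 'n) set"
  assumes C: "C \<in> codes TYPE('k::finite) t" and p: "bij p" and a: "\<And>l. a l \<noteq> 0"
  shows "monomial_map p a ` C \<in> codes TYPE('k) t"
proof -
  let ?f = "monomial_map p a"
  note lin = linear_monomial_map[of p a] and inj = inj_monomial_map[where a = a, OF p a]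
  obtain G :: "'a ^ 'n ^ 'k" where G: "generator_matrix G C" "any_columns_independent t G"
    using C by (auto simp: codes_def)
  let ?G = "\<chi> r. ?f (G $ r)"
  have row: "row i ?G = ?f (row i G)" for i
    by (simp add: row_def)
  have rows: "rows ?G = ?f ` rows G"
    by (auto simp: rows_def row)
  have "inj (\<lambda>i. row i ?G)"
    using inj_compose[OF inj, of "\<lambda>i. row i G"] G(1)
    by (simp add: row generator_matrix_def comp_def)
  moreover have "vec.independent (rows ?G)"
    unfolding rows using G(1) inj
    by (intro vec.linear_independent_injective_image[OF lin])
      (auto simp: generator_matrix_def intro: inj_on_subset)
  moreover have "vec.span (rows ?G) = ?f ` C"
    unfolding rows using G(1)
    by (simp add: vec.linear_span_image[OF lin] generator_matrix_def)
  ultimately have "generator_matrix ?G (?f ` C)"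
    by (simp add: generator_matrix_def)
  moreover have "linear_code CARD('k) (?f ` C)"
    using C vec.linear_subspace_image[OF lin] vec.dim_image_eq[OF lin inj_on_subset[OF inj]]
    by (auto simp: codes_def linear_code_def)
  ultimately show ?thesis
    using any_columns_independent_monomial[where a = a, OF G(2) p a] unfolding codes_def by blast
qed

section \<open>Rank-one perturbations of the identity\<close>

lemma dim_Int_image_rank_one_perturbation:
  fixes C :: "('a::field ^ 'n) set"
  assumes C: "vec.subspace C" and lin: "Vector_Spaces.linear (*s) (*s) f"
    and w: "\<And>x. \<exists>c. f x - x = c *s w"
  shows "vec.dim C \<le> vec.dim (C \<inter> f ` C) + 1"
proof (cases "\<forall>x\<in>C. f x = x")
  case True
  then have "f ` C = C" by force
  then show ?thesis by simp
next
  case False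
  then obtain v where v: "v \<in> C" "f v \<noteq> v" by blast
  obtain c where c: "f v - v = c *s w" using w by blast
  with v have "c \<noteq> 0" by auto
  have "C \<subseteq> vec.span (insert v (C \<inter> f ` C))"
  proof
    fix x assume x: "x \<in> C"
    obtain d where d: "f x - x = d *s w" using w by blast
    \<comment> \<open>The factor \<open>d / c\<close> makes the displacement of \<open>v\<close>
      cancel that of \<open>x\<close>, so \<open>?y\<close> is fixed.\<close>
    let ?y = "x - (d / c) *s v"
    have "?y \<in> C" using C x v(1) by (simp add: vec.subspace_diff vec.subspace_scale)
    moreover have "f ?y - ?y = (f x - x) - (d / c) *s (f v - v)"
      by (simp add: vec.linear_diff[OF lin] vec.linear_scale[OF lin])
    then have "f ?y = ?y" using \<open>c \<noteq> 0\<close> by (simp add: c d)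
    ultimately have "?y \<in> C \<inter> f ` C" by (metis IntI imageI)
    then show "x \<in> vec.span (insert v (C \<inter> f ` C))"
      by (auto simp: vec.span_insert intro: vec.span_base)
  qed
  then have "vec.dim C \<le> vec.dim (insert v (C \<inter> f ` C))"
    using vec.dim_mono by blast
  also have "\<dots> \<le> vec.dim (C \<inter> f ` C) + 1"
    by (simp add: vec.dim_insert)
  finally show ?thesis .
qed

text \<open>The path has length zero if the image is \<open>C\<close> itself, and is a single edge
  otherwise: two distinct codes of dimension \<open>k\<close> cannot meet in dimension
  \<open>k\<close>.\<close>

lemma rank_one_perturbation_reachable:
  fixes C :: "('a::field ^ 'n) set"
  assumes C: "C \<in> codes TYPE('k::finite) t" and p: "bij p" and a: "\<And>l. a l \<noteq> 0"
    and w: "\<And>x. \<exists>c. monomial_map p a x - x = c *s w"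
  shows "(C, monomial_map p a ` C) \<in> (code_graph_edges TYPE('k) t)\<^sup>*"
proof (cases "monomial_map p a ` C = C")
  case False
  let ?D = "monomial_map p a ` C"
  have D: "?D \<in> codes TYPE('k) t" by (rule codes_monomial_image[OF C p a])
  have sub: "vec.subspace C" "vec.dim C = CARD('k)" "vec.subspace ?D" "vec.dim ?D = CARD('k)"
    using C D by (auto simp: codes_def linear_code_def)
  have "vec.dim (C \<inter> ?D) \<noteq> CARD('k)"
  proof
    assume "vec.dim (C \<inter> ?D) = CARD('k)"
    then have "C \<inter> ?D = C" "C \<inter> ?D = ?D"
      using sub by (intro vec.subspace_dim_equal vec.subspace_inter; simp)+
    with False show False by blast
  qed
  moreover have "vec.dim (C \<inter> ?D) \<le> CARD('k)"
    using vec.dim_subset[of "C \<inter> ?D" C] sub(2) by simp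
  moreover have "CARD('k) \<le> vec.dim (C \<inter> ?D) + 1"
    using dim_Int_image_rank_one_perturbation[OF sub(1) linear_monomial_map w] sub(2) by simp
  ultimately have "vec.dim (C \<inter> ?D) = CARD('k) - 1" by linarith
  then show ?thesis using C D by (auto simp: code_graph_edges_def)
qed simp

section \<open>Paths built from generators\<close>

lemma diagonal_reachable:
  fixes C :: "('a::field ^ 'n) set"
  assumes C: "C \<in> codes TYPE('k::finite) t" and a: "\<And>l. a l \<noteq> 0"
  shows "(C, monomial_map id a ` C) \<in> (code_graph_edges TYPE('k) t)\<^sup>*"
proof -
  \<comment> \<open>Coordinates are rescaled one at a time: \<open>S\<close> collects those already
    treated, and \<open>S = UNIV\<close> gives the full diagonal map.\<close>
  have "(C, monomial_map id (\<lambda>l. if l \<in> S then a l else 1) ` C) \<in> (code_graph_edges TYPE('k) t)\<^sup>*"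
    for S using finite[of S]
  proof (induction S rule: finite_induct)
    case empty
    have "monomial_map id (\<lambda>l. 1) = (id :: 'a ^ 'n \<Rightarrow> _)"
      by (simp add: fun_eq_iff monomial_map_def)
    then show ?case by (simp add: id_def)
  next
    case (insert i S)
    let ?b = "\<lambda>l. if l \<in> S then a l else 1" and ?s = "\<lambda>l. if l = i then a i else 1"
    let ?D = "monomial_map id ?b ` C"
    have D: "?D \<in> codes TYPE('k) t"
      by (rule codes_monomial_image[OF C]) (auto simp: a)
    have "monomial_map id ?s x - x = ((a i - 1) * x $ i) *s axis i 1" for x :: "'a ^ 'n"
      by (simp add: monomial_map_def vec_eq_iff axis_def algebra_simps)
    then have "(?D, monomial_map id ?s ` ?D) \<in> (code_graph_edges TYPE('k) t)\<^sup>*"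
      by (intro rank_one_perturbation_reachable[OF D]) (auto simp: a)
    moreover have "monomial_map id ?s ` ?D
        = monomial_map id (\<lambda>l. if l \<in> insert i S then a l else 1) ` C"
      unfolding image_image using insert(2)
      by (intro image_cong) (auto simp: monomial_map_def vec_eq_iff)
    ultimately show ?case using insert.IH by (simp add: id_def)
  qed
  from this[of UNIV] show ?thesis by simp
qed

lemma permutation_reachable:
  fixes C :: "('a::field ^ 'n) set"
  assumes C: "C \<in> codes TYPE('k::finite) t" and p: "bij p"
  shows "(C, monomial_map p (\<lambda>_. 1) ` C) \<in> (code_graph_edges TYPE('k) t)\<^sup>*"
proof -
  have "p permutes UNIV" using p by (simp add: permutes_univ bij_iff)
  with finite[of UNIV] show ?thesis
  \<comment> \<open>This induction multiplies by a transposition on the right, which matches the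
    reversed composition: applying \<open>?s\<close> after \<open>p\<close> yields
    \<open>p \<circ> ?s\<close>.\<close>
  proof (induction rule: permutes_rev_induct)
    case id
    have "monomial_map id (\<lambda>l. 1) = (id :: 'a ^ 'n \<Rightarrow> _)"
      by (simp add: fun_eq_iff monomial_map_def)
    then show ?case by (simp add: id_def)
  next
    case (swap i j p)
    let ?D = "monomial_map p (\<lambda>_. 1) ` C" and ?s = "Transposition.transpose i j"
    have D: "?D \<in> codes TYPE('k) t"
      using swap by (intro codes_monomial_image[OF C]) (auto simp: permutes_bij)
    \<comment> \<open>Swapping two coordinates moves every vector along the fixed direction
      \<open>axis i 1 - axis j 1\<close>.\<close>
    have "monomial_map ?s (\<lambda>_. 1) x - x = (x $ j - x $ i) *s (axis i 1 - axis j 1)"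
      for x :: "'a ^ 'n"
      by (auto simp: monomial_map_def vec_eq_iff axis_def Transposition.transpose_def)
    then have "(?D, monomial_map ?s (\<lambda>_. 1) ` ?D) \<in> (code_graph_edges TYPE('k) t)\<^sup>*"
      by (intro rank_one_perturbation_reachable[OF D]) (simp, simp, blast)
    moreover have "monomial_map ?s (\<lambda>_. 1) ` ?D = monomial_map (p \<circ> ?s) (\<lambda>_. 1) ` C"
      by (simp add: image_image monomial_map_def)
    ultimately show ?case using swap.IH by (simp add: comp_def)
  qed
qed

lemma monomial_reachable:
  fixes C :: "('a::field ^ 'n) set"
  assumes C: "C \<in> codes TYPE('k::finite) t" and p: "bij p" and a: "\<And>l. a l \<noteq> 0"
  shows "(C, monomial_map p a ` C) \<in> (code_graph_edges TYPE('k) t)\<^sup>*"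
proof -
  have "monomial_map p (\<lambda>_. 1) ` C \<in> codes TYPE('k) t"
    by (rule codes_monomial_image[OF C p]) simp
  from diagonal_reachable[where a = a, OF this a] permutation_reachable[OF C p]
  show ?thesis
    unfolding monomial_map_factor[of p a] image_comp[symmetric] by simp
qed

section \<open>The monomial group in coordinates\<close>

text \<open>Since coordinate lines go to coordinate lines, each basis vector goes to a multiple of a
  basis vector. Injectivity of \<open>f\<close> makes these multiples nonzero and the index map
  injective, hence bijective by finiteness.\<close>

lemma monomial_group_eq_monomial_map:
  fixes f :: "'a::field ^ 'n \<Rightarrow> 'a ^ 'n"
  assumes "f \<in> carrier monomial_group"
  obtains p a where "bij p" "\<And>l. a l \<noteq> 0" "f = monomial_map p a"
proof -
  have lin: "Vector_Spaces.linear (*s) (*s) f" and bij: "bij f"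
    and lines: "(\<lambda>L. f ` L) ` coordinate_lines = coordinate_lines"
    using assms by (auto simp: monomial_group_def)
  have "\<exists>j c. f (axis i 1) = c *s axis j 1" for i
  proof -
    have "f ` vec.span {axis i 1} \<in> coordinate_lines"
      using lines unfolding coordinate_lines_def by blast
    then obtain j where "f ` vec.span {axis i 1} = vec.span {axis j 1}"
      by (auto simp: coordinate_lines_def)
    then have "f (axis i 1) \<in> vec.span {axis j 1}"
      using vec.span_base by blast
    then show ?thesis by (auto simp: vec.span_singleton)
  qed
  then obtain s c where f: "f (axis i 1) = c i *s axis (s i) 1" for i
    by metis
  have c0: "c i \<noteq> 0" for i
  proof
    assume "c i = 0"
    then have "f (axis i 1) = f 0" by (simp add: f vec.linear_0[OF lin])
    then have "axis i (1::'a) = 0" using bij by (simp add: bij_is_inj inj_eq)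
    then show False by (simp add: axis_eq_0_iff)
  qed
  have "inj s"
  proof (rule injI)
    fix i j assume "s i = s j"
    \<comment> \<open>Cross-multiplying gives both arguments the same image, a multiple by
      \<open>c i * c j\<close> of one basis vector.\<close>
    then have "f (c j *s axis i 1) = f (c i *s axis j 1)"
      by (simp add: vec.linear_scale[OF lin] f mult.commute)
    then have "c j *s axis i 1 = c i *s axis j (1::'a)"
      using bij by (simp add: bij_is_inj inj_eq)
    then have "(c j *s axis i 1) $ i = (c i *s axis j (1::'a)) $ i" by simp
    with c0[of j] show "i = j" by (auto simp: axis_def split: if_splits)
  qed
  then have s: "bij s" by (simp add: bij_def finite_UNIV_inj_surj)
  \<comment> \<open>\<open>s\<close> and \<open>c\<close> are indexed by source positions,
    \<open>monomial_map\<close> by target positions; hence the inverse.\<close>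
  let ?p = "Hilbert_Choice.inv s"
  have "f x = monomial_map ?p (c \<circ> ?p) x" for x
  proof -
    have "f x = f (\<Sum>i\<in>UNIV. x $ i *s axis i 1)"
      by (simp add: basis_expansion)
    also have "\<dots> = (\<Sum>i\<in>UNIV. (x $ i * c i) *s axis (s i) 1)"
      by (simp add: vec.linear_sum[OF lin] vec.linear_scale[OF lin] f)
    also have "\<dots> = monomial_map ?p (c \<circ> ?p) x"
    proof -
      have "(\<Sum>i\<in>UNIV. x $ i * c i * axis (s i) 1 $ l) = c (?p l) * x $ ?p l" for l
      proof -
        have eq: "l = s i \<longleftrightarrow> i = ?p l" for i
          using s by (metis bij_inv_eq_iff)
        have "(\<Sum>i\<in>UNIV. x $ i * c i * axis (s i) 1 $ l)
            = (\<Sum>i\<in>UNIV. if i = ?p l then x $ i * c i else 0)"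
          by (intro sum.cong) (auto simp: axis_def eq)
        then show ?thesis by (simp add: mult.commute)
      qed
      then show ?thesis by (simp add: monomial_map_def vec_eq_iff)
    qed
    finally show ?thesis .
  qed
  then have "f = monomial_map ?p (c \<circ> ?p)" by blast
  with that[of ?p "c \<circ> ?p"] show thesis
    using s c0 by (simp add: bij_imp_bij_inv)
qed

theorem theorem2p3:
  fixes C :: "('a::{field,finite} ^ 'n) set" and t :: nat
  assumes "CARD('k::finite) < CARD('n)"
    and "t \<le> CARD('k)"
    and "C \<in> codes TYPE('k) t"
  shows "\<exists>K \<in> connected_components (codes TYPE('k) t) (code_graph_edges TYPE('k) t).
           orbit monomial_group (\<lambda>f X. f ` X) C \<subseteq> K"
proof -
  let ?V = "codes TYPE('k) t :: ('a ^ 'n) set set"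
  \<comment> \<open>Components are the classes of this relation, so the class of \<open>C\<close> is
    the component sought.\<close>
  let ?R = "{(X, Y). X \<in> ?V \<and> Y \<in> ?V \<and> (X, Y) \<in> (code_graph_edges TYPE('k) t)\<^sup>*}"
  have "orbit monomial_group (\<lambda>f X. f ` X) C \<subseteq> ?R `` {C}"
  proof
    fix D assume "D \<in> orbit monomial_group (\<lambda>f X. f ` X) C"
    then obtain f where "f \<in> carrier monomial_group" and D: "D = f ` C"
      by (auto simp: orbit_def)
    then obtain p a where "bij p" "\<And>l. a l \<noteq> 0" "f = monomial_map p a"
      by (metis monomial_group_eq_monomial_map)
    then show "D \<in> ?R `` {C}"
      using assms(3) codes_monomial_image[OF assms(3)]
        monomial_reachable[OF assms(3)]
      by (simp add: D)
  qed
  moreover have "?R `` {C} \<in> connected_components ?V (code_graph_edges TYPE('k) t)"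
    using assms(3) unfolding connected_components_def by (rule quotientI)
  ultimately show ?thesis by blast
qed

end
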